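(* Let $G\in\mathcal{G}_{n,m}$ and let $G^*$ be its core. For any target matrix $M\in\mathcal{P}(\mathcal{S}_{G^*})$, there exists a pair $(A,B)\in\mathbb{V}(G^* )$ such that \[ \mathcal{C}^{\mathrm{tr}}(A,B)=M . \]
   Context: Setting. $\Sigma$ is a manifold, possibly with boundary, of dimension $d\ge 1$, and $\mu$ is a Borel probability measure on $\Sigma$. There exists a nonempty open set $\mathcal{O}\subseteq\operatorname{supp}\mu$ such that $\mu|_{\mathcal O}$ is absolutely continuous with respect to a smooth volume measure on $\mathcal O$. Graphs. $\mathcal{G}_{n,m}$ is the set of digraphs $G=(V,E)$ (self-loops allowed) whose node set is the disjoint union of $V_\alpha=\{\alpha_1,\dots,\alpha_n\}$ and $V_\beta=\{\beta_1,\dots,\beta_m\}$, such that no $\beta$-node has an in-neighbor. $uv$ denotes the directed edge from $u$ to $v$. Core. A self-loop counts as a cycle. A strong component is nontrivial if it contains a cycle. $V_{\mathrm{cyc}}$ is the set of nodes in nontrivial strong components of $G$, and $V_{\mathrm{cyc}}^+$ is $V_{\mathrm{cyc}}$ together with all nodes reachable by a directed path from a node of $V_{\mathrm{cyc}}$. The core $G^*$ is the subgraph of $G$ induced by $V^*:=V\setminus V_{\mathrm{cyc}}^+$; it is acyclic and contains all $\beta$-nodes. Let $n^*:=|V^*\cap V_\alpha|$; without loss of generality the $\alpha$-nodes of $G^*$ are $\alpha_1,\dots,\alpha_{n^*}$. When $n^*=0$, the matrices below have zero rows. $\mathbb{V}(G^* )$ is the set of pairs $(A,B)\in L^\infty(\Sigma;\mathbb{R}^{n^*\times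 n^*})\times L^\infty(\Sigma;\mathbb{R}^{n^*\times m})$ (bounded measurable matrix-valued functions) such that $A_{jk}$ is the zero function whenever $\alpha_k\alpha_j$ is not an edge of $G^*$ and $B_{ji}$ is the zero function whenever $\beta_i\alpha_j$ is not an edge of $G^*$. For such a pair, \[ \mathcal{C}^{\mathrm{tr}}(A,B):=\left[\int_\Sigma B\,d\mu,\ \int_\Sigma AB\,d\mu,\ \dots,\ \int_\Sigma A^{n^*-1}B\,d\mu\right]\in\mathbb{R}^{n^*\times mn^*}. \] $\mathcal{S}_{G^*}\in\{0,\ast\}^{n^*\times mn^*}$ is the pattern with $(\mathcal{S}_{G^*})_{h,(k-1)m+i}=\ast$ if there is a path of length $k$ (i.e. with $k$ edges) from $\beta_i$ to $\alpha_h$ in $G^*$, and $0$ otherwise, for $h,k\in\{1,\dots,n^*\}$, $i\in\{1,\dots,m\}$. For a pattern $\mathcal{S}\in\{0,\ast\}^{r\times s}$, $\mathcal{P}(\mathcal{S}):=\{M\in\mathbb{R}^{r\times s}: M_{ij}=0\text{ whenever }\mathcal{S}_{ij}=0\}$. *)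

theory Defs
  imports
    "HOL-Probability.Probability"
    "Graph_Theory.Graph_Theory"
    "Jordan_Normal_Form.Matrix"
begin

section \<open>Smooth manifolds with boundary and smooth volume measures\<close>

primrec Ck_on :: "nat \<Rightarrow> ('a::euclidean_space \<Rightarrow> 'b::real_normed_vector) \<Rightarrow> 'a set \<Rightarrow> bool" where
  "Ck_on 0 f S \<longleftrightarrow> continuous_on S f"
| "Ck_on (Suc k) f S \<longleftrightarrow>
     (\<forall>x\<in>S. f differentiable (at x)) \<and> (\<forall>v. Ck_on k (\<lambda>x. frechet_derivative f (at x) v) S)"

text \<open>On an arbitrary set (in particular on a relatively open subset of a half-space),
  smoothness means local extendability to a smooth function on an open set.\<close>

definition smooth_on :: "'a::euclidean_space set \<Rightarrow> ('a \<Rightarrow> 'b::real_normed_vector) \<Rightarrow> bool" where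
  "smooth_on S f \<longleftrightarrow>
     (\<forall>x\<in>S. \<exists>W g. open W \<and> x \<in> W \<and> (\<forall>k. Ck_on k g W) \<and> (\<forall>y\<in>W \<inter> S. g y = f y))"

definition half_space :: "'e::euclidean_space set" where
  "half_space = {x. 0 \<le> x \<bullet> (SOME b. b \<in> Basis)}"

type_synonym ('s, 'e) chart = "'s set \<times> ('s \<Rightarrow> 'e)"

text \<open>The values of the second component outside the first are irrelevant.  Charts may take
  values in the whole model space or in the half-space.\<close>

definition is_chart :: "('s::topological_space, 'e::euclidean_space) chart \<Rightarrow> bool" where
  "is_chart c \<longleftrightarrow> (case c of (U, \<phi>) \<Rightarrow>
     open U \<and> (open (\<phi> ` U) \<or> openin (top_of_set half_space) (\<phi> ` U)) \<and>
     homeomorphism U (\<phi> ` U) \<phi> (inv_into U \<phi>))"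

text \<open>The manifold is the whole type \<open>'s\<close>; its dimension is \<open>DIM('e)\<close>, which is at least one.\<close>

definition smooth_manifold_with_boundary ::
  "('s::{t2_space, second_countable_topology}, 'e::euclidean_space) chart set \<Rightarrow> bool" where
  "smooth_manifold_with_boundary \<A> \<longleftrightarrow>
     (\<forall>c\<in>\<A>. is_chart c) \<and> (\<Union>c\<in>\<A>. fst c) = UNIV \<and>
     (\<forall>(U, \<phi>)\<in>\<A>. \<forall>(V, \<psi>)\<in>\<A>. smooth_on (\<phi> ` (U \<inter> V)) (\<psi> \<circ> inv_into U \<phi>))"

text \<open>A measure on the open set \<open>\<Omega>\<close> with a smooth positive Lebesgue density in every chart.\<close>

definition smooth_volume_measure ::
  "('s::topological_space, 'e::euclidean_space) chart set \<Rightarrow> 's set \<Rightarrow> 's measure \<Rightarrow> bool" where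
  "smooth_volume_measure \<A> \<Omega> \<nu> \<longleftrightarrow>
     sets \<nu> = sets (restrict_space borel \<Omega>) \<and>
     (\<forall>(U, \<phi>)\<in>\<A>. \<exists>\<rho> :: 'e \<Rightarrow> real.
        smooth_on (\<phi> ` (U \<inter> \<Omega>)) \<rho> \<and> (\<forall>y\<in>\<phi> ` (U \<inter> \<Omega>). 0 < \<rho> y) \<and>
        distr (restrict_space \<nu> U) borel \<phi> =
          density lborel (\<lambda>y. ennreal (\<rho> y) * indicator (\<phi> ` (U \<inter> \<Omega>)) y))"

definition measure_support :: "'s::topological_space measure \<Rightarrow> 's set" where
  "measure_support \<mu> = {x. \<forall>U. open U \<and> x \<in> U \<longrightarrow> 0 < emeasure \<mu> U}"


section \<open>Digraphs and their cores\<close>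

text \<open>Indices are zero-based: \<open>Alpha j\<close> is $\alpha_{j+1}$ and \<open>Beta i\<close> is $\beta_{i+1}$.
  A pair \<open>(u, v)\<close> is the edge from \<open>u\<close> to \<open>v\<close>.\<close>

datatype node = Alpha nat | Beta nat

definition alpha_nodes :: "nat \<Rightarrow> node set" where
  "alpha_nodes n = Alpha ` {..<n}"

definition beta_nodes :: "nat \<Rightarrow> node set" where
  "beta_nodes m = Beta ` {..<m}"

definition digraphs :: "nat \<Rightarrow> nat \<Rightarrow> node pair_pre_digraph set" where
  "digraphs n m = {G. pair_wf_digraph G \<and> pverts G = alpha_nodes n \<union> beta_nodes m \<and>
     (\<forall>(u, v)\<in>parcs G. v \<notin> beta_nodes m)}"

definition V_cyc :: "('a, 'b) pre_digraph \<Rightarrow> 'a set" where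
  "V_cyc G = \<Union> {verts H | H. H \<in> pre_digraph.sccs G \<and> (\<exists>p. pre_digraph.cycle H p)}"

definition V_cyc_plus :: "('a, 'b) pre_digraph \<Rightarrow> 'a set" where
  "V_cyc_plus G = V_cyc G \<union> {v. \<exists>u\<in>V_cyc G. u \<rightarrow>\<^sup>*\<^bsub>G\<^esub> v}"

definition core :: "('a, 'b) pre_digraph \<Rightarrow> ('a, 'b) pre_digraph" where
  "core G = induce_subgraph G (verts G - V_cyc_plus G)"

definition core_alpha :: "nat \<Rightarrow> node pair_pre_digraph \<Rightarrow> node set" where
  "core_alpha n G = verts (core (with_proj G)) \<inter> alpha_nodes n"

definition core_dim :: "nat \<Rightarrow> node pair_pre_digraph \<Rightarrow> nat" where
  "core_dim n G = card (core_alpha n G)"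

text \<open>A numbering of the $\alpha$-nodes of the core, the node \<open>a j\<close> belonging to row \<open>j\<close> of the
  matrices below.  It replaces the relabelling of nodes after which the $\alpha$-nodes of the core
  are the first ones; in that case \<open>Alpha\<close> itself is a numbering.\<close>

definition core_numbering :: "nat \<Rightarrow> node pair_pre_digraph \<Rightarrow> (nat \<Rightarrow> node) \<Rightarrow> bool" where
  "core_numbering n G a \<longleftrightarrow> bij_betw a {..<core_dim n G} (core_alpha n G)"


section \<open>Patterns\<close>

text \<open>In a pattern, \<open>True\<close> stands for the symbol $\ast$ and \<open>False\<close> for $0$.\<close>

definition pattern_class :: "bool mat \<Rightarrow> real mat set" where
  "pattern_class S = {M \<in> carrier_mat (dim_row S) (dim_col S).
     \<forall>i<dim_row S. \<forall>j<dim_col S. \<not> S $$ (i, j) \<longrightarrow> M $$ (i, j) = 0}"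

text \<open>With zero-based indices the column of $\beta_i$ in the block of paths of length $k$ is
  $c = (k-1)m + (i-1)$, so that \<open>c div m = k - 1\<close> and \<open>c mod m = i - 1\<close>.\<close>

definition core_pattern :: "nat \<Rightarrow> nat \<Rightarrow> node pair_pre_digraph \<Rightarrow> (nat \<Rightarrow> node) \<Rightarrow> bool mat" where
  "core_pattern n m G a = mat (core_dim n G) (m * core_dim n G)
     (\<lambda>(h, c). \<exists>p. pre_digraph.apath (core (with_proj G)) (Beta (c mod m)) p (a h) \<and>
        length p = c div m + 1)"


section \<open>Structured pairs and the truncated controllability matrix\<close>

definition bounded_measurable_mats :: "'s measure \<Rightarrow> nat \<Rightarrow> nat \<Rightarrow> ('s \<Rightarrow> real mat) set" where
  "bounded_measurable_mats \<mu> r s = {F. (\<forall>x\<in>space \<mu>. F x \<in> carrier_mat r s) \<and>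
     (\<forall>i<r. \<forall>j<s. (\<lambda>x. F x $$ (i, j)) \<in> borel_measurable \<mu> \<and>
        bounded ((\<lambda>x. F x $$ (i, j)) ` space \<mu>))}"

definition core_pairs :: "'s measure \<Rightarrow> nat \<Rightarrow> nat \<Rightarrow> node pair_pre_digraph \<Rightarrow> (nat \<Rightarrow> node) \<Rightarrow>
    (('s \<Rightarrow> real mat) \<times> ('s \<Rightarrow> real mat)) set" where
  "core_pairs \<mu> n m G a = {(A, B).
     A \<in> bounded_measurable_mats \<mu> (core_dim n G) (core_dim n G) \<and>
     B \<in> bounded_measurable_mats \<mu> (core_dim n G) m \<and>
     (\<forall>j<core_dim n G. \<forall>k<core_dim n G. (a k, a j) \<notin> arcs (core (with_proj G)) \<longrightarrow>
        (\<forall>x\<in>space \<mu>. A x $$ (j, k) = 0)) \<and>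
     (\<forall>j<core_dim n G. \<forall>i<m. (Beta i, a j) \<notin> arcs (core (with_proj G)) \<longrightarrow>
        (\<forall>x\<in>space \<mu>. B x $$ (j, i) = 0))}"

definition mat_integral :: "'s measure \<Rightarrow> nat \<Rightarrow> nat \<Rightarrow> ('s \<Rightarrow> real mat) \<Rightarrow> real mat" where
  "mat_integral \<mu> r s F = mat r s (\<lambda>(i, j). \<integral>x. F x $$ (i, j) \<partial>\<mu>)"

text \<open>For \<open>A\<close> of size $N \times N$ and \<open>B\<close> of size $N \times m$, the blocks
  $\int A^k B\,d\mu$ for $k = 0, \dots, N-1$ side by side.\<close>

definition ctrb_tr :: "'s measure \<Rightarrow> nat \<Rightarrow> nat \<Rightarrow> ('s \<Rightarrow> real mat) \<Rightarrow> ('s \<Rightarrow> real mat) \<Rightarrow> real mat" where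
  "ctrb_tr \<mu> N m A B = mat N (m * N)
     (\<lambda>(h, c). mat_integral \<mu> N m (\<lambda>x. (A x ^\<^sub>m (c div m)) * B x) $$ (h, c mod m))"

end

theory Submission
  imports Defs
begin

text \<open>For fixed \<open>A\<close> the tuple \<open>(B, A B, A\<^sup>2 B, \<dots>)\<close> is linear in \<open>B\<close>.  Points of the open set are
  null while its open subsets are not, so it contains arbitrarily many disjoint open sets of
  positive measure; step functions on these, with \<open>B\<close> rescaled by the measures, therefore realize
  every linear combination of tuples of constant structured pairs.  A path
  \<open>\<beta>, v\<^sub>1, \<dots>, v\<^sub>k\<close> with unit weights has the tuple \<open>e\<^bsub>v\<^sub>1\<^esub>, \<dots>, e\<^bsub>v\<^sub>k\<^esub>, 0, \<dots>\<close>; subtracting the tuple of the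
  path stopped at \<open>v\<^bsub>k-1\<^esub>\<close> leaves a single unit entry, and these entries span the pattern class.\<close>

section \<open>Disjoint open sets of positive measure\<close>

text \<open>The function \<open>f\<close> need not be measurable: if \<open>density\<close> is degenerate it is the zero measure.\<close>

lemma emeasure_density_lborel_singleton:
  fixes y :: "'e::euclidean_space"
  shows "emeasure (density lborel f) {y} = 0"
proof -
  have "AE x in lborel. f x * indicator {y} x = 0"
    using AE_lborel_singleton[of y] by eventually_elim auto
  then have "(\<integral>\<^sup>+ x. f x * indicator {y} x \<partial>lborel) = (\<integral>\<^sup>+ x. 0 \<partial>(lborel :: 'e measure))"
    by (rule nn_integral_cong_AE)
  then show ?thesis
    unfolding density_def emeasure_measure_of_conv by simp
qed

text \<open>A chart at \<open>x\<close> is injective and pushes \<open>\<nu>\<close> forward to a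
  measure with a Lebesgue density, and points of a Euclidean space of positive dimension are
  Lebesgue-null.\<close>

lemma smooth_volume_measure_singleton_null:
  fixes \<A> :: "('s::{t2_space, second_countable_topology}, 'e::euclidean_space) chart set"
  assumes mf: "smooth_manifold_with_boundary \<A>" and vol: "smooth_volume_measure \<A> \<Omega> \<nu>"
    and op: "open \<Omega>" and x: "x \<in> \<Omega>"
  shows "{x} \<in> null_sets \<nu>"
proof -
  have s: "sets \<nu> = sets (restrict_space borel \<Omega>)"
    using vol by (simp add: smooth_volume_measure_def)
  have "x \<in> (\<Union>c\<in>\<A>. fst c)"
    using mf by (simp add: smooth_manifold_with_boundary_def)
  then obtain U \<phi> where c: "(U, \<phi>) \<in> \<A>" and xU: "x \<in> U"
    by force
  have "is_chart (U, \<phi>)"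
    using c mf by (auto simp: smooth_manifold_with_boundary_def)
  then have opU: "open U" and hom: "homeomorphism U (\<phi> ` U) \<phi> (inv_into U \<phi>)"
    by (auto simp: is_chart_def)
  obtain f where d: "distr (restrict_space \<nu> U) borel \<phi> = density lborel f"
    using vol c by (auto simp: smooth_volume_measure_def)
  \<comment> \<open>Continuity of \<open>\<phi>\<close> is known only on \<open>U\<close>, so its
    measurability is read off the Borel sets of \<open>\<Omega> \<inter> U\<close>.\<close>
  have sU: "sets (restrict_space \<nu> U) = sets (restrict_space borel (\<Omega> \<inter> U))"
    using sets_restrict_space_cong[OF s] op opU by (simp add: restrict_restrict_space)
  have spU: "space (restrict_space \<nu> U) = \<Omega> \<inter> U"
    using sets_eq_imp_space_eq[OF sU] by (simp add: space_restrict_space)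
  have "continuous_on (\<Omega> \<inter> U) \<phi>"
    using hom by (auto simp: homeomorphism_def intro: continuous_on_subset)
  then have meas: "\<phi> \<in> measurable (restrict_space \<nu> U) borel"
    using borel_measurable_continuous_on_restrict measurable_cong_sets[OF sU refl] by blast
  have "inj_on \<phi> U"
    using hom by (metis homeomorphism_def inj_on_inverseI)
  then have vim: "\<phi> -` {\<phi> x} \<inter> space (restrict_space \<nu> U) = {x}"
    using x xU by (auto simp: spU dest: inj_onD)
  have "emeasure (restrict_space \<nu> U) {x} = emeasure (density lborel f) {\<phi> x}"
    using emeasure_distr[OF meas, of "{\<phi> x}"] by (simp add: d vim)
  then have "emeasure (restrict_space \<nu> U) {x} = 0"
    by (simp add: emeasure_density_lborel_singleton)
  moreover have "space \<nu> = \<Omega>"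
    using sets_eq_imp_space_eq[OF s] by (simp add: space_restrict_space)
  moreover have "U \<inter> \<Omega> \<in> sets \<nu>" and "{x} \<in> sets \<nu>"
    using op opU x by (auto simp: s sets_restrict_space_iff)
  ultimately show ?thesis
    using xU by (auto simp: emeasure_restrict_space)
qed

text \<open>Two distinct points of \<open>W\<close> have disjoint neighbourhoods: one, cut down to
  \<open>W\<close>, becomes the new member, the other houses the remaining members. The absence of
  open singletons passes to open subsets, which keeps the induction going.\<close>

lemma disjoint_open_family:
  fixes W :: "'s::t2_space set"
  assumes "finite I" and "open W" and "W \<noteq> {}"
    and "\<And>V x. open V \<Longrightarrow> V \<subseteq> W \<Longrightarrow> V \<noteq> {x}"
  shows "\<exists>E. disjoint_family_on E I \<and> (\<forall>i\<in>I. open (E i) \<and> E i \<noteq> {} \<and> E i \<subseteq> W)"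
  using assms
proof (induction I arbitrary: W rule: finite_induct)
  case empty
  then show ?case by (auto simp: disjoint_family_on_def)
next
  case (insert i I)
  obtain x y where xy: "x \<in> W" "y \<in> W" "x \<noteq> y"
    using insert.prems(2) insert.prems(3)[OF insert.prems(1)] by blast
  obtain U V where UV: "open U" "open V" "x \<in> U" "y \<in> V" "U \<inter> V = {}"
    using hausdorff[OF xy(3)] by blast
  have "\<exists>E. disjoint_family_on E I \<and> (\<forall>i\<in>I. open (E i) \<and> E i \<noteq> {} \<and> E i \<subseteq> W \<inter> V)"
    using insert.prems UV xy by (intro insert.IH) auto
  then obtain E where E: "disjoint_family_on E I"
    "\<forall>i\<in>I. open (E i) \<and> E i \<noteq> {} \<and> E i \<subseteq> W \<inter> V" by blast
  show ?case
  proof (intro exI conjI)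
    show "disjoint_family_on (E(i := W \<inter> U)) (insert i I)"
      using E UV insert.hyps unfolding disjoint_family_on_def by (auto; blast)
    show "\<forall>j\<in>insert i I. open ((E(i := W \<inter> U)) j) \<and> (E(i := W \<inter> U)) j \<noteq> {}
        \<and> (E(i := W \<inter> U)) j \<subseteq> W"
      using E UV xy insert.prems(1) by auto
  qed
qed

text \<open>Nonempty open subsets of \<open>\<Omega>\<close> have positive mass because
  \<open>\<Omega>\<close> lies in the support, while its points are null by absolute continuity. So
  no open subset is a singleton, and repeated splitting applies.\<close>

lemma disjoint_positive_measure_family:
  fixes \<A> :: "('s::{t2_space, second_countable_topology}, 'e::euclidean_space) chart set"
  assumes mf: "smooth_manifold_with_boundary \<A>" and fm: "finite_measure \<mu>"
    and s: "sets \<mu> = sets borel"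
    and op: "open \<Omega>" "\<Omega> \<noteq> {}" "\<Omega> \<subseteq> measure_support \<mu>"
    and vol: "smooth_volume_measure \<A> \<Omega> \<nu>"
    and ac: "absolutely_continuous \<nu> (restrict_space \<mu> \<Omega>)"
    and fin: "finite I"
  shows "\<exists>E. disjoint_family_on E I \<and> (\<forall>i\<in>I. E i \<in> sets \<mu> \<and> 0 < measure \<mu> (E i))"
proof -
  have pos: "0 < emeasure \<mu> V" if "open V" "V \<subseteq> \<Omega>" "V \<noteq> {}" for V
    using that op(3) by (auto simp: measure_support_def)
  have null: "emeasure \<mu> {x} = 0" if "x \<in> \<Omega>" for x
  proof -
    have "{x} \<in> null_sets (restrict_space \<mu> \<Omega>)"
      using ac smooth_volume_measure_singleton_null[OF mf vol op(1) that]
      by (auto simp: absolutely_continuous_def)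
    moreover have "\<Omega> \<in> sets \<mu>"
      using op(1) by (simp add: s)
    ultimately show ?thesis
      by (auto simp: null_sets_restrict_space)
  qed
  have "V \<noteq> {x}" if "open V" "V \<subseteq> \<Omega>" for V x
    using pos[OF that] null[of x] that by auto
  then obtain E where E: "disjoint_family_on E I"
    "\<forall>i\<in>I. open (E i) \<and> E i \<noteq> {} \<and> E i \<subseteq> \<Omega>"
    using disjoint_open_family[OF fin op(1,2)] by blast
  have "0 < measure \<mu> (E i)" if "i \<in> I" for i
    using pos[of "E i"] E(2) that finite_measure.emeasure_eq_measure[OF fm, of "E i"] by auto
  then show ?thesis
    using E by (auto simp: s)
qed

section \<open>Step functions with matrix values\<close>

text \<open>The entrywise sum of indicators lets measurability, boundedness and forced zero entries
  pass from the summands; off all \<open>E i\<close> the value is the zero matrix.\<close>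

definition step_mat ::
  "('i \<Rightarrow> 's set) \<Rightarrow> 'i set \<Rightarrow> nat \<Rightarrow> nat \<Rightarrow> ('i \<Rightarrow> real mat) \<Rightarrow> 's \<Rightarrow> real mat" where
  "step_mat E I r s F x = mat r s (\<lambda>jk. \<Sum>i\<in>I. indicator (E i) x * F i $$ jk)"

lemma step_mat_carrier [simp]: "step_mat E I r s F x \<in> carrier_mat r s"
  by (simp add: step_mat_def)

lemma sum_indicator_disjoint:
  fixes g :: "'i \<Rightarrow> real"
  assumes "finite I" "disjoint_family_on E I" "i \<in> I" "x \<in> E i"
  shows "(\<Sum>j\<in>I. indicator (E j) x * g j) = g i"
proof -
  have "indicator (E j) x * g j = (if j = i then g j else 0)" if "j \<in> I" for j
    using assms that by (auto simp: indicator_def disjoint_family_on_def)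
  then have "(\<Sum>j\<in>I. indicator (E j) x * g j) = (\<Sum>j\<in>I. if j = i then g j else 0)"
    by (rule sum.cong[OF refl])
  then show ?thesis
    using assms by simp
qed

lemma step_mat_inside:
  assumes "finite I" "disjoint_family_on E I" "i \<in> I" "x \<in> E i" "F i \<in> carrier_mat r s"
  shows "step_mat E I r s F x = F i"
  using assms(5) sum_indicator_disjoint[OF assms(1-4)]
  by (intro eq_matI) (simp_all add: step_mat_def)

lemma step_mat_outside:
  assumes "\<forall>i\<in>I. x \<notin> E i"
  shows "step_mat E I r s F x = 0\<^sub>m r s"
  using assms by (intro eq_matI) (auto simp: step_mat_def)

lemma step_mat_bounded_measurable:
  assumes "finite I" "\<And>i. i \<in> I \<Longrightarrow> E i \<in> sets \<mu>"
  shows "step_mat E I r s F \<in> bounded_measurable_mats \<mu> r s"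
proof -
  have "(\<lambda>x. step_mat E I r s F x $$ (j, k)) \<in> borel_measurable \<mu> \<and>
      bounded ((\<lambda>x. step_mat E I r s F x $$ (j, k)) ` space \<mu>)" if "j < r" "k < s" for j k
  proof -
    have eq: "(\<lambda>x. step_mat E I r s F x $$ (j, k)) = (\<lambda>x. \<Sum>i\<in>I. indicator (E i) x * F i $$ (j, k))"
      using that by (simp add: step_mat_def)
    have "\<bar>\<Sum>i\<in>I. indicator (E i) x * F i $$ (j, k)\<bar> \<le> (\<Sum>i\<in>I. \<bar>F i $$ (j, k)\<bar>)" for x
      by (rule order_trans[OF sum_abs]) (auto intro!: sum_mono simp: indicator_def)
    then have "bounded (range (\<lambda>x. \<Sum>i\<in>I. indicator (E i) x * F i $$ (j, k)))"
      by (auto simp: bounded_iff)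
    then have "bounded ((\<lambda>x. step_mat E I r s F x $$ (j, k)) ` space \<mu>)"
      unfolding eq by (rule bounded_subset) auto
    moreover have "(\<lambda>x. step_mat E I r s F x $$ (j, k)) \<in> borel_measurable \<mu>"
      unfolding eq using assms(2)
      by (intro borel_measurable_sum borel_measurable_times borel_measurable_indicator) auto
    ultimately show ?thesis by blast
  qed
  then show ?thesis
    by (auto simp: bounded_measurable_mats_def)
qed

text \<open>On each \<open>E i\<close> both factors are constant, so the product is again a step
  function, supported on the same sets.\<close>

lemma integral_step_mat_power:
  assumes fin: "finite I" and dj: "disjoint_family_on E I"
    and E: "\<And>i. i \<in> I \<Longrightarrow> E i \<in> sets \<mu>" and fm: "finite_measure \<mu>"
    and A: "\<And>i. i \<in> I \<Longrightarrow> A i \<in> carrier_mat N N"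
    and B: "\<And>i. i \<in> I \<Longrightarrow> B i \<in> carrier_mat N m"
    and h: "h < N" and c: "c < m"
  shows "(\<integral>x. (step_mat E I N N A x ^\<^sub>m k * step_mat E I N m B x) $$ (h, c) \<partial>\<mu>) =
    (\<Sum>i\<in>I. measure \<mu> (E i) * (A i ^\<^sub>m k * B i) $$ (h, c))"
proof -
  interpret finite_measure \<mu> by fact
  have "(step_mat E I N N A x ^\<^sub>m k * step_mat E I N m B x) $$ (h, c) =
    (\<Sum>i\<in>I. indicator (E i) x * (A i ^\<^sub>m k * B i) $$ (h, c))" for x
  proof (cases "\<exists>i\<in>I. x \<in> E i")
    case True
    then obtain i where i: "i \<in> I" "x \<in> E i" by blast
    show ?thesis
      using step_mat_inside[where F = A, OF fin dj i A[OF i(1)]]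
        step_mat_inside[where F = B, OF fin dj i B[OF i(1)]]
      by (simp add: sum_indicator_disjoint[OF fin dj i])
  next
    case False
    \<comment> \<open>It is the second factor whose vanishing counts: for \<open>k = 0\<close> the
      power is the identity matrix even where its base is zero.\<close>
    then have "step_mat E I N m B x = 0\<^sub>m N m"
      by (intro step_mat_outside) auto
    then show ?thesis
      using False h c
      by (simp add: right_mult_zero_mat[OF pow_carrier_mat[OF step_mat_carrier]])
  qed
  then have "(\<integral>x. (step_mat E I N N A x ^\<^sub>m k * step_mat E I N m B x) $$ (h, c) \<partial>\<mu>) =
    (\<integral>x. (\<Sum>i\<in>I. indicator (E i) x * (A i ^\<^sub>m k * B i) $$ (h, c)) \<partial>\<mu>)"
    by presburger
  also have "\<dots> = (\<Sum>i\<in>I. \<integral>x. indicator (E i) x * (A i ^\<^sub>m k * B i) $$ (h, c) \<partial>\<mu>)"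
    using E by (intro Bochner_Integration.integral_sum integrable_mult_left
        integrable_real_indicator) (auto simp: less_top[symmetric])
  also have "\<dots> = (\<Sum>i\<in>I. measure \<mu> (E i) * (A i ^\<^sub>m k * B i) $$ (h, c))"
    using E sets.sets_into_space by (intro sum.cong) (auto simp: Int_absorb2)
  finally show ?thesis .
qed

section \<open>Matrices of paths\<close>

text \<open>A path visits the rows \<open>u 0, \<dots>, u (r - 1)\<close>.\<close>

definition path_mat :: "nat \<Rightarrow> (nat \<Rightarrow> nat) \<Rightarrow> nat \<Rightarrow> real mat" where
  "path_mat N u r = mat N N (\<lambda>(x, y). if \<exists>j. Suc j < r \<and> x = u (Suc j) \<and> y = u j then 1 else 0)"

text \<open>A token on row \<open>u j\<close> for the input column \<open>i\<close>. Past the end of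
  the path it is zero, so that stopping needs no separate case.\<close>

definition path_unit :: "nat \<Rightarrow> nat \<Rightarrow> (nat \<Rightarrow> nat) \<Rightarrow> nat \<Rightarrow> nat \<Rightarrow> nat \<Rightarrow> real mat" where
  "path_unit N m u r i j = mat N m (\<lambda>(x, y). if j < r \<and> x = u j \<and> y = i then 1 else 0)"

lemma path_mat_carrier [simp]: "path_mat N u r \<in> carrier_mat N N"
  by (simp add: path_mat_def)

lemma path_unit_carrier [simp]: "path_unit N m u r i j \<in> carrier_mat N m"
  by (simp add: path_unit_def)

text \<open>By injectivity, for \<open>j < r\<close> column \<open>u j\<close> of the path matrix
  has at most one nonzero entry, in row \<open>u (Suc j)\<close>, and none at the last vertex.
  Multiplication thus moves the token one vertex onward.\<close>

lemma path_mat_times_unit: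
  assumes inj: "inj_on u {..<r}" and ran: "\<And>j. j < r \<Longrightarrow> u j < N"
  shows "path_mat N u r * path_unit N m u r i j = path_unit N m u r i (Suc j)"
proof (rule eq_matI)
  fix x y assume "x < dim_row (path_unit N m u r i (Suc j))" "y < dim_col (path_unit N m u r i (Suc j))"
  then have xy: "x < N" "y < m" by (auto simp: path_unit_def)
  have "(path_mat N u r * path_unit N m u r i j) $$ (x, y) =
      (\<Sum>z = 0..<N. path_mat N u r $$ (x, z) * path_unit N m u r i j $$ (z, y))"
    using xy by (simp add: path_mat_def path_unit_def scalar_prod_def)
  also have "\<dots> = (\<Sum>z = 0..<N. if z = u j then
      (if j < r \<and> y = i then path_mat N u r $$ (x, z) else 0) else 0)"
    using xy by (intro sum.cong) (auto simp: path_unit_def)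
  also have "\<dots> = (if u j < N \<and> j < r \<and> y = i then path_mat N u r $$ (x, u j) else 0)"
    by simp
  also have "\<dots> = path_unit N m u r i (Suc j) $$ (x, y)"
  proof (cases "j < r")
    case True
    have "(\<exists>j'. Suc j' < r \<and> x = u (Suc j') \<and> u j = u j') \<longleftrightarrow> Suc j < r \<and> x = u (Suc j)"
      using inj True by (auto dest!: inj_onD)
    then show ?thesis
      using xy True ran[OF True] by (auto simp: path_mat_def path_unit_def)
  qed (use xy in \<open>simp add: path_unit_def\<close>)
  finally show "(path_mat N u r * path_unit N m u r i j) $$ (x, y) =
    path_unit N m u r i (Suc j) $$ (x, y)" .
qed (simp_all add: path_mat_def path_unit_def)

lemma path_mat_power_times_unit:
  assumes "inj_on u {..<r}" and "\<And>j. j < r \<Longrightarrow> u j < N"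
  shows "path_mat N u r ^\<^sub>m k * path_unit N m u r i j = path_unit N m u r i (j + k)"
proof (induction k arbitrary: j)
  case 0
  show ?case
    by (simp add: left_mult_one_mat[OF path_unit_carrier] path_mat_def[of N u r])
next
  case (Suc k)
  \<comment> \<open>The factor next to the token is split off, so the induction hypothesis is used
    at \<open>Suc j\<close>.\<close>
  have "path_mat N u r ^\<^sub>m Suc k * path_unit N m u r i j =
      path_mat N u r ^\<^sub>m k * (path_mat N u r * path_unit N m u r i j)"
    by (simp add: assoc_mult_mat[OF pow_carrier_mat[OF path_mat_carrier] path_mat_carrier
          path_unit_carrier])
  also have "\<dots> = path_unit N m u r i (j + Suc k)"
    by (simp add: path_mat_times_unit[OF assms] Suc.IH)
  finally show ?case .
qed

section \<open>Paths in the core\<close>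

lemma core_tail_head [simp]:
  "tail (core (with_proj G)) = fst" "head (core (with_proj G)) = snd"
  by (simp_all add: core_def)

text \<open>Converts the recursive notion of a walk into conditions on list positions, which match
  the row sequences used for path matrices.\<close>

lemma cas_nth:
  assumes "pre_digraph.cas G u p v"
  shows "\<And>j. Suc j < length p \<Longrightarrow> tail G (p ! Suc j) = head G (p ! j)"
    and "p \<noteq> [] \<Longrightarrow> tail G (p ! 0) = u"
    and "p \<noteq> [] \<Longrightarrow> head G (p ! (length p - 1)) = v"
proof -
  have "(\<forall>j. Suc j < length p \<longrightarrow> tail G (p ! Suc j) = head G (p ! j)) \<and>
    (p \<noteq> [] \<longrightarrow> tail G (p ! 0) = u \<and> head G (p ! (length p - 1)) = v)"
    using assms
  proof (induction p arbitrary: u)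
    case (Cons e p)
    then have "tail G e = u" "pre_digraph.cas G (head G e) p v"
      by (auto simp: pre_digraph.cas.simps)
    with Cons.IH[OF this(2)] show ?case
      by (cases "p = []") (auto simp: nth_Cons pre_digraph.cas.simps split: nat.splits)
  qed simp
  then show "\<And>j. Suc j < length p \<Longrightarrow> tail G (p ! Suc j) = head G (p ! j)"
    and "p \<noteq> [] \<Longrightarrow> tail G (p ! 0) = u"
    and "p \<noteq> [] \<Longrightarrow> head G (p ! (length p - 1)) = v"
    by auto
qed

text \<open>No arc enters a \<beta>-node; hence every vertex of a core path after the first has a
  row number.\<close>

lemma core_arc_head:
  assumes "G \<in> digraphs n m" "e \<in> arcs (core (with_proj G))"
  shows "snd e \<in> core_alpha n G"
proof -
  have "snd e \<in> verts (core (with_proj G))" "e \<in> parcs G"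
    using assms(2) by (auto simp: core_def)
  moreover have "snd e \<notin> beta_nodes m"
    using assms(1) \<open>e \<in> parcs G\<close> by (cases e) (auto simp: digraphs_def)
  ultimately show ?thesis
    using assms(1) by (auto simp: core_alpha_def core_def digraphs_def)
qed

text \<open>Here \<open>u j\<close> numbers the head of the arc at position \<open>j\<close>. The
  starting \<beta>-node has no row, so a path with \<open>Suc k\<close> arcs yields the rows
  \<open>u 0\<close> to \<open>u k\<close>.\<close>

lemma core_path_rows:
  assumes G: "G \<in> digraphs n m" and num: "core_numbering n G a"
    and path: "pre_digraph.apath (core (with_proj G)) (Beta i) p (a h)"
    and len: "length p = Suc k" and h: "h < core_dim n G"
  obtains u where "inj_on u {..k}" "\<And>j. j \<le> k \<Longrightarrow> u j < core_dim n G" "u k = h"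
    "(Beta i, a (u 0)) \<in> arcs (core (with_proj G))"
    "\<And>j. j < k \<Longrightarrow> (a (u j), a (u (Suc j))) \<in> arcs (core (with_proj G))"
proof -
  let ?C = "core (with_proj G)" and ?N = "core_dim n G"
  have arcs: "set p \<subseteq> arcs ?C" and cas: "pre_digraph.cas ?C (Beta i) p (a h)"
    and dist: "distinct (pre_digraph.awalk_verts ?C (Beta i) p)"
    using path by (auto simp: pre_digraph.apath_def pre_digraph.awalk_def)
  have ne: "p \<noteq> []" using len by auto
  note nth = cas_nth[OF cas, unfolded core_tail_head]
  have bij: "bij_betw a {..<?N} (core_alpha n G)"
    using num by (simp add: core_numbering_def)
  have ex: "\<exists>l<?N. a l = snd (p ! j)" if "j \<le> k" for j
  proof -
    have "p ! j \<in> arcs ?C"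
      using arcs len that nth_mem[of j p] by auto
    then have "snd (p ! j) \<in> a ` {..<?N}"
      using core_arc_head[OF G] bij by (auto simp: bij_betw_def)
    then show ?thesis by auto
  qed
  define u where "u j = (SOME l. l < ?N \<and> a l = snd (p ! j))" for j
  have u: "u j < ?N" "a (u j) = snd (p ! j)" if "j \<le> k" for j
    using someI_ex[OF ex[OF that]] unfolding u_def by auto
  \<comment> \<open>The vertices of a nonempty walk are its start followed by the heads of its
    arcs.\<close>
  have "distinct (map snd p)"
    using dist pre_digraph.awalk_verts_conv'[OF cas] ne by simp
  then have inj: "inj_on u {..k}"
    using u(2) len
    by (intro inj_onI) (metis atMost_iff le_imp_less_Suc distinct_conv_nth length_map nth_map)
  have edge: "(fst (p ! j), snd (p ! j)) \<in> arcs ?C" if "j \<le> k" for j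
    using arcs len that nth_mem[of j p] by auto
  show thesis
  proof
    \<comment> \<open>Both rows carry the end node of the path, and the numbering is
      injective.\<close>
    show "u k = h"
      using u[of k] nth(3)[OF ne] h bij len by (auto simp: bij_betw_def dest: inj_onD)
    show "(Beta i, a (u 0)) \<in> arcs ?C"
      using edge[of 0] nth(2)[OF ne] u(2)[of 0] by simp
    show "(a (u j), a (u (Suc j))) \<in> arcs ?C" if "j < k" for j
      using edge[of "Suc j"] nth(1)[of j] u(2)[of j] u(2)[of "Suc j"] that len by simp
  qed (use inj u in auto)
qed

section \<open>Realization of the pattern class\<close>

theorem theorem3p1:
  fixes \<A> :: "('s::{t2_space, second_countable_topology}, 'e::euclidean_space) chart set"
    and \<mu> :: "'s measure" and n m :: nat and G :: "node pair_pre_digraph"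
    and a :: "nat \<Rightarrow> node" and M :: "real mat"
  assumes "smooth_manifold_with_boundary \<A>"
    and "prob_space \<mu>" and "sets \<mu> = sets borel"
    and "\<exists>\<Omega> \<nu>. open \<Omega> \<and> \<Omega> \<noteq> {} \<and> \<Omega> \<subseteq> measure_support \<mu> \<and>
           smooth_volume_measure \<A> \<Omega> \<nu> \<and> absolutely_continuous \<nu> (restrict_space \<mu> \<Omega>)"
    and "G \<in> digraphs n m"
    and "core_numbering n G a"
    and "M \<in> pattern_class (core_pattern n m G a)"
  shows "\<exists>(A, B) \<in> core_pairs \<mu> n m G a. ctrb_tr \<mu> (core_dim n G) m A B = M"
proof -
  define N where "N = core_dim n G"
  define C where "C = core (with_proj G)"
  interpret prob_space \<mu> by fact
  \<comment> \<open>The positions of the stars: \<open>M\<close> is the sum of its entries there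
    times unit matrices, and each star supplies a path.\<close>
  define K where "K = {(h, c). h < N \<and> c < m * N \<and>
    (\<exists>p. pre_digraph.apath C (Beta (c mod m)) p (a h) \<and> length p = c div m + 1)}"
  have finK: "finite K"
    by (rule finite_subset[of _ "{..<N} \<times> {..<m * N}"]) (auto simp: K_def)
  have M: "M \<in> carrier_mat N (m * N)"
    and M0: "\<And>h c. h < N \<Longrightarrow> c < m * N \<Longrightarrow> (h, c) \<notin> K \<Longrightarrow> M $$ (h, c) = 0"
    using assms(7) by (auto simp: pattern_class_def core_pattern_def K_def N_def C_def)
  have "\<exists>u. inj_on u {..c div m} \<and> (\<forall>j\<le>c div m. u j < N) \<and> u (c div m) = h \<and>
      (Beta (c mod m), a (u 0)) \<in> arcs C \<and> (\<forall>j<c div m. (a (u j), a (u (Suc j))) \<in> arcs C)"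
    if "(h, c) \<in> K" for h c
  proof -
    obtain p where "h < core_dim n G"
      "pre_digraph.apath (core (with_proj G)) (Beta (c mod m)) p (a h)" "length p = Suc (c div m)"
      using \<open>(h, c) \<in> K\<close> by (auto simp: K_def N_def C_def)
    then show ?thesis
      unfolding N_def C_def by (metis core_path_rows[OF assms(5,6)])
  qed
  then have "\<forall>hc. \<exists>u. hc \<in> K \<longrightarrow> inj_on u {..snd hc div m} \<and> (\<forall>j\<le>snd hc div m. u j < N) \<and>
      u (snd hc div m) = fst hc \<and> (Beta (snd hc mod m), a (u 0)) \<in> arcs C \<and>
      (\<forall>j<snd hc div m. (a (u j), a (u (Suc j))) \<in> arcs C)"
    by (metis prod.collapse)
  then obtain U where "\<forall>hc. hc \<in> K \<longrightarrow> inj_on (U hc) {..snd hc div m} \<and>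
      (\<forall>j\<le>snd hc div m. U hc j < N) \<and>
      U hc (snd hc div m) = fst hc \<and> (Beta (snd hc mod m), a (U hc 0)) \<in> arcs C \<and>
      (\<forall>j<snd hc div m. (a (U hc j), a (U hc (Suc j))) \<in> arcs C)"
    by (rule choice[THEN exE])
  then have U_inj: "\<And>hc. hc \<in> K \<Longrightarrow> inj_on (U hc) {..snd hc div m}"
    and U_less: "\<And>hc j. hc \<in> K \<Longrightarrow> j \<le> snd hc div m \<Longrightarrow> U hc j < N"
    and U_last: "\<And>hc. hc \<in> K \<Longrightarrow> U hc (snd hc div m) = fst hc"
    and U_first: "\<And>hc. hc \<in> K \<Longrightarrow> (Beta (snd hc mod m), a (U hc 0)) \<in> arcs C"
    and U_step: "\<And>hc j. hc \<in> K \<Longrightarrow> j < snd hc div m \<Longrightarrow> (a (U hc j), a (U hc (Suc j))) \<in> arcs C"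
    by auto

  \<comment> \<open>Two sets per star: one for its path, one for the same path without its last
    vertex.\<close>
  define I where "I = K \<times> (UNIV :: bool set)"
  have finI: "finite I"
    using finK by (simp add: I_def)
  obtain E where dj: "disjoint_family_on E I" and E: "\<And>i. i \<in> I \<Longrightarrow> E i \<in> sets \<mu>"
    and Epos: "\<And>i. i \<in> I \<Longrightarrow> 0 < measure \<mu> (E i)"
    using assms(4)
      disjoint_positive_measure_family[OF assms(1) finite_measure_axioms assms(3) _ _ _ _ _ finI]
    by metis

  \<comment> \<open>The flag tells whether the path keeps its last vertex.\<close>
  define r where "r i = (case i of (hc, s) \<Rightarrow> snd hc div m + of_bool s)"
    for i :: "(nat \<times> nat) \<times> bool"
  \<comment> \<open>The division offsets the mass gained on integration; the sign subtracts the
    shortened path.\<close>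
  define w where "w i = (case i of (hc, s) \<Rightarrow> (if s then 1 else - 1) * M $$ hc / measure \<mu> (E i))"
    for i :: "(nat \<times> nat) \<times> bool"
  define AA where "AA i = path_mat N (U (fst i)) (r i)" for i
  \<comment> \<open>The weight sits in \<open>BB\<close> alone, since the products are linear in
    this factor but not in \<open>AA\<close>. A one-arc path has shortened length
    \<open>r i = 0\<close>, which makes \<open>BB i\<close> zero.\<close>
  define BB where "BB i = w i \<cdot>\<^sub>m path_unit N m (U (fst i)) (r i) (snd (fst i) mod m) 0" for i
  define A where "A = step_mat E I N N AA"
  define B where "B = step_mat E I N m BB"
  have r_le: "r i \<le> Suc (snd (fst i) div m)" for i
    by (cases i) (simp add: r_def)

  \<comment> \<open>Nonzero entries of \<open>AA i\<close> come only from consecutive vertices of a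
    core path, and shortening the path adds none.\<close>
  have "A x $$ (j, k) = 0" if "j < N" "k < N" "(a k, a j) \<notin> arcs C" for x j k
  proof -
    have "AA i $$ (j, k) = 0" if "i \<in> I" for i
      using \<open>j < N\<close> \<open>k < N\<close> \<open>(a k, a j) \<notin> arcs C\<close> U_step[of "fst i"] r_le[of i] that
      by (fastforce simp: AA_def path_mat_def I_def)
    then show ?thesis
      using that by (simp add: A_def step_mat_def)
  qed
  moreover have "B x $$ (j, k) = 0" if "j < N" "k < m" "(Beta k, a j) \<notin> arcs C" for x j k
  proof -
    have "BB i $$ (j, k) = 0" if "i \<in> I" for i
      using \<open>j < N\<close> \<open>k < m\<close> \<open>(Beta k, a j) \<notin> arcs C\<close> U_first[of "fst i"] that
      by (auto simp: BB_def path_unit_def I_def)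
    then show ?thesis
      using that by (simp add: B_def step_mat_def)
  qed
  ultimately have pair: "(A, B) \<in> core_pairs \<mu> n m G a"
    using step_mat_bounded_measurable[OF finI E, of _ N N AA]
      step_mat_bounded_measurable[OF finI E, of _ N m BB]
    by (simp add: core_pairs_def A_def B_def N_def C_def)

  have entry: "measure \<mu> (E i) * (AA i ^\<^sub>m k * BB i) $$ (h, l) = (case i of (hc, s) \<Rightarrow>
      (if s then 1 else - 1) * M $$ hc * of_bool (k < r i \<and> h = U hc k \<and> l = snd hc mod m))"
    if i: "i \<in> I" and "h < N" "l < m" for i k h l
  proof -
    have K: "fst i \<in> K" using i by (auto simp: I_def)
    have sub: "{..<r i} \<subseteq> {..snd (fst i) div m}"
      using r_le[of i] by auto
    have "AA i ^\<^sub>m k * BB i = w i \<cdot>\<^sub>m path_unit N m (U (fst i)) (r i) (snd (fst i) mod m) k"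
      unfolding AA_def BB_def
      using path_mat_power_times_unit[OF inj_on_subset[OF U_inj[OF K] sub], of N k m]
        U_less[OF K] sub
      by (subst mult_smult_distrib[OF pow_carrier_mat[OF path_mat_carrier] path_unit_carrier])
        (auto simp: subset_iff)
    then show ?thesis
      using that Epos[OF i] by (cases i) (auto simp: path_unit_def w_def)
  qed

  have "ctrb_tr \<mu> N m A B = M"
  proof (rule eq_matI)
    fix h c assume "h < dim_row M" "c < dim_col M"
    then have h: "h < N" and c: "c < m * N" using M by auto
    \<comment> \<open>The bound on \<open>c\<close> rules out \<open>m = 0\<close>.\<close>
    then have m: "c mod m < m"
      by (metis mod_less_divisor mult_is_0 not_gr_zero not_less_zero)
    \<comment> \<open>The two flags give opposite terms at every step before the last and zero after
      it. At the last step only the full path contributes, in row \<open>fst hc\<close>; quotient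
      and remainder then determine the column.\<close>
    have cancel: "(\<Sum>s\<in>UNIV. (if s then 1 else - 1) * M $$ hc *
        of_bool (c div m < r (hc, s) \<and> h = U hc (c div m) \<and> c mod m = snd hc mod m)) =
      (if hc = (h, c) then M $$ hc else 0)" if "hc \<in> K" for hc
    proof -
      have "c div m = snd hc div m \<and> c mod m = snd hc mod m \<longleftrightarrow> snd hc = c"
        by (metis div_mult_mod_eq)
      moreover have "(\<Sum>s\<in>UNIV. g s) = g True + g False" for g :: "bool \<Rightarrow> real"
        by (simp add: UNIV_bool)
      ultimately show ?thesis
        using U_last[OF that] by (cases hc) (auto simp: r_def)
    qed
    have "ctrb_tr \<mu> N m A B $$ (h, c) = (\<integral>x. (A x ^\<^sub>m (c div m) * B x) $$ (h, c mod m) \<partial>\<mu>)"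
      using h c m by (simp add: ctrb_tr_def mat_integral_def)
    also have "\<dots> = (\<Sum>i\<in>I. measure \<mu> (E i) * (AA i ^\<^sub>m (c div m) * BB i) $$ (h, c mod m))"
      unfolding A_def B_def
      by (rule integral_step_mat_power[OF finI dj E finite_measure_axioms _ _ h m])
        (auto simp: AA_def BB_def)
    also have "\<dots> = (\<Sum>(hc, s)\<in>I. (if s then 1 else - 1) * M $$ hc *
        of_bool (c div m < r (hc, s) \<and> h = U hc (c div m) \<and> c mod m = snd hc mod m))"
      using entry[OF _ h m] by (intro sum.cong) auto
    also have "\<dots> = (\<Sum>hc\<in>K. if hc = (h, c) then M $$ hc else 0)"
      unfolding I_def by (subst sum.cartesian_product[symmetric]) (simp only: cancel cong: sum.cong)
    \<comment> \<open>If \<open>(h, c)\<close> is not a star, no summand matches and the entry of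
      \<open>M\<close> is zero as well.\<close>
    also have "\<dots> = M $$ (h, c)"
      using finK M0[OF h c] by auto
    finally show "ctrb_tr \<mu> N m A B $$ (h, c) = M $$ (h, c)" .
  qed (use M in \<open>auto simp: ctrb_tr_def\<close>)
  then show ?thesis
    using pair by (auto simp: N_def)
qed

end
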